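(* Let $(G,\cdot)$ be a group and let $\psi:G\to G$ be an abelian map. Define $\phi:G\to G$ by $\phi(g)=g\psi(g^{-1})$ and $g\circ h=g\psi(g^{-1})h\psi(g)$ for $g,h\in G$, and let $\cdot'$ and $\circ'$ be the operations opposite to $\cdot$ and $\circ$. Let $H\le (G,\cdot)$ be a subgroup, and consider the two conditions $$C_1:\ [G,\phi(H)]\le H;\qquad\qquad C_2:\ H\trianglelefteq (G,\cdot).$$ Then: 1. $H$ is a strong left ideal of the braces $(G,\circ,\cdot)$ and $(G,\circ',\cdot)$ if and only if $C_1$ holds. 2. $H$ is a strong left ideal of the braces $(G,\cdot,\circ)$ and $(G,\cdot',\circ)$ if and only if $C_2$ holds. 3. $H$ is an ideal of the braces $(G,\cdot,\circ)$, $(G,\cdot',\circ)$ and $(G,\circ',\cdot)$ if and only if both $C_1$ and $C_2$ hold.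
   Context: A brace (skew left brace) is a triple $(B,\star,\bullet)$ where $(B,\star)$ (the additive group) and $(B,\bullet)$ (the multiplicative group) are groups, neither assumed abelian, with $a\bullet(b\star c)=(a\bullet b)\star a^{-1}\star(a\bullet c)$ for all $a,b,c\in B$, where $a^{-1}$ is the inverse in $(B,\star)$. Put $\gamma(a)[b]=a^{-1}\star(a\bullet b)$ (inverse in $(B,\star)$). A subset $H\subseteq B$ is a strong left ideal of $(B,\star,\bullet)$ if $H\le(B,\bullet)$, $H\trianglelefteq(B,\star)$, and $\gamma(a)[H]\subseteq H$ for all $a\in B$. A strong left ideal $H$ is an ideal if in addition $H\trianglelefteq(B,\bullet)$. An abelian map on a group $G$ is a group endomorphism $\psi:G\to G$ whose image $\psi(G)$ is abelian. It is known that for such $\psi$ the operation $g\circ h=g\psi(g^{-1})h\psi(g)$ makes $G$ a group, that $(G,\cdot,\circ)$ and $(G,\circ,\cdot)$ are both braces, and that $\phi:(G,\circ)\to(G,\cdot)$ is a homomorphism. The opposite operations are $g\cdot' h=h\cdot g$ and $g\circ' h=h\circ g$; then $(G,\cdot',\circ)$ and $(G,\circ',\cdot)$ are also braces. Juxtaposition and $g^{-1}$ refer to $(G,\cdot)$. Commutators are $[a,b]=aba^{-1}b^{-1}$ in $(G,\cdot)$, and $[G,\phi(H)]$ is the subgroup of $(G,\cdot)$ generated by all $[g,\phi(h)]$, $g\in G$, $h\in H$. *)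

theory Defs
  imports "HOL-Algebra.Generated_Groups"
begin

text \<open>A skew left brace is a pair of group structures, additive \<open>A\<close> and multiplicative \<open>M\<close>,
  on the same carrier. Neither group is assumed abelian, and the unit fields are not required
  to coincide (equality of the two units follows from the brace law).\<close>

locale skew_brace =
  additive: group A + multiplicative: group M
  for A (structure) and M (structure) +
  assumes carrier_eq: "carrier M = carrier A"
    and brace_law:
      "\<lbrakk>a \<in> carrier A; b \<in> carrier A; c \<in> carrier A\<rbrakk> \<Longrightarrow>
        a \<otimes>\<^bsub>M\<^esub> (b \<otimes>\<^bsub>A\<^esub> c) = (a \<otimes>\<^bsub>M\<^esub> b) \<otimes>\<^bsub>A\<^esub> inv\<^bsub>A\<^esub> a \<otimes>\<^bsub>A\<^esub> (a \<otimes>\<^bsub>M\<^esub> c)"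

definition brace_gamma ::
    "('a, 'b) monoid_scheme \<Rightarrow> ('a, 'c) monoid_scheme \<Rightarrow> 'a \<Rightarrow> 'a \<Rightarrow> 'a" where
  "brace_gamma A M a b = inv\<^bsub>A\<^esub> a \<otimes>\<^bsub>A\<^esub> (a \<otimes>\<^bsub>M\<^esub> b)"

locale strong_left_ideal =
  skew_brace A M + multiplicative: subgroup H M + additive: normal H A
  for H and A (structure) and M (structure) +
  assumes gamma_closed: "a \<in> carrier A \<Longrightarrow> brace_gamma A M a ` H \<subseteq> H"

locale brace_ideal =
  strong_left_ideal H A M + multiplicative: normal H M
  for H and A (structure) and M (structure)

definition abelian_map :: "('a, 'b) monoid_scheme \<Rightarrow> ('a \<Rightarrow> 'a) \<Rightarrow> bool" where
  "abelian_map G \<psi> \<longleftrightarrow> \<psi> \<in> hom G G \<and> comm_group (G\<lparr>carrier := \<psi> ` carrier G\<rparr>)"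

definition phi_map :: "('a, 'b) monoid_scheme \<Rightarrow> ('a \<Rightarrow> 'a) \<Rightarrow> 'a \<Rightarrow> 'a" where
  "phi_map G \<psi> g = g \<otimes>\<^bsub>G\<^esub> \<psi> (inv\<^bsub>G\<^esub> g)"

text \<open>The group \<open>(G, \<circ>)\<close>. It has the same unit as \<open>G\<close>, so only the multiplication is replaced.\<close>

definition circle_group ::
    "('a, 'b) monoid_scheme \<Rightarrow> ('a \<Rightarrow> 'a) \<Rightarrow> ('a, 'b) monoid_scheme" where
  "circle_group G \<psi> = G\<lparr>mult := \<lambda>g h. g \<otimes>\<^bsub>G\<^esub> \<psi> (inv\<^bsub>G\<^esub> g) \<otimes>\<^bsub>G\<^esub> h \<otimes>\<^bsub>G\<^esub> \<psi> g\<rparr>"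

definition opposite_group :: "('a, 'b) monoid_scheme \<Rightarrow> ('a, 'b) monoid_scheme" where
  "opposite_group G = G\<lparr>mult := \<lambda>g h. h \<otimes>\<^bsub>G\<^esub> g\<rparr>"

definition commutator_subgroup ::
    "('a, 'b) monoid_scheme \<Rightarrow> 'a set \<Rightarrow> 'a set \<Rightarrow> 'a set" where
  "commutator_subgroup G X Y =
    generate G {x \<otimes>\<^bsub>G\<^esub> y \<otimes>\<^bsub>G\<^esub> inv\<^bsub>G\<^esub> x \<otimes>\<^bsub>G\<^esub> inv\<^bsub>G\<^esub> y | x y. x \<in> X \<and> y \<in> Y}"

end

theory Submission
  imports Defs
begin

text \<open>Both conditions are read off from explicit formulas: conjugating \<open>h\<close> by \<open>g\<close> in \<open>(G, \<circ>)\<close>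
  gives \<open>[\<phi> g, \<phi> h] h\<close>, while \<open>\<gamma>(g)[h]\<close> is \<open>\<psi>(g) h \<psi>(g)\<^sup>-\<^sup>1 = [\<psi> g, \<phi> h] h\<close> for \<open>(G, \<circ>, \<cdot>)\<close>,
  \<open>[g, \<phi> h] h\<close> for \<open>(G, \<circ>', \<cdot>)\<close>, and a conjugate of \<open>h\<close> in \<open>G\<close> for the other two braces.
  Commutators with \<open>\<psi> G\<close> and \<open>\<phi> G\<close> control all commutators since \<open>g = \<psi>(g) \<phi>(\<psi>(g)\<^sup>-\<^sup>1 g \<psi>(g))\<close>.\<close>

section \<open>Opposite groups and opposite braces\<close>

lemma opposite_group_simps [simp]:
  "carrier (opposite_group G) = carrier G"
  "a \<otimes>\<^bsub>opposite_group G\<^esub> b = b \<otimes>\<^bsub>G\<^esub> a"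
  "\<one>\<^bsub>opposite_group G\<^esub> = \<one>\<^bsub>G\<^esub>"
  by (simp_all add: opposite_group_def)

lemma group_opposite_group:
  assumes "group G" shows "group (opposite_group G)"
proof -
  interpret group G by fact
  show ?thesis by (rule groupI) (auto simp: m_assoc intro: r_inv_ex)
qed

lemma inv_opposite_group:
  assumes "group G" "a \<in> carrier G"
  shows "inv\<^bsub>opposite_group G\<^esub> a = inv\<^bsub>G\<^esub> a"
proof -
  interpret group G by fact
  show ?thesis
    by (rule group.inv_equality[OF group_opposite_group]) (simp_all add: assms)
qed

lemma subgroup_opposite_group:
  assumes "group G"
  shows "subgroup H (opposite_group G) \<longleftrightarrow> subgroup H G"
  using inv_opposite_group[OF assms]
  by (fastforce simp: subgroup_def subset_iff)

text \<open>Conjugation by \<open>x\<close> in the opposite group is conjugation by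
  \<open>inv x\<close> in \<open>G\<close>, and inversion permutes the carrier.\<close>

lemma normal_opposite_group:
  assumes "group G"
  shows "H \<lhd> opposite_group G \<longleftrightarrow> H \<lhd> G"
proof -
  interpret group G by fact
  interpret opp: group "opposite_group G" by (rule group_opposite_group) fact
  let ?P = "\<lambda>x. \<forall>h\<in>H. x \<otimes>\<^bsub>G\<^esub> h \<otimes>\<^bsub>G\<^esub> inv\<^bsub>G\<^esub> x \<in> H"
  have "(\<forall>x\<in>carrier G. ?P (inv\<^bsub>G\<^esub> x)) \<longleftrightarrow> (\<forall>x\<in>carrier G. ?P x)"
    by (metis inv_closed inv_inv)
  moreover have "x \<otimes>\<^bsub>opposite_group G\<^esub> h \<otimes>\<^bsub>opposite_group G\<^esub> inv\<^bsub>opposite_group G\<^esub> x =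
      inv\<^bsub>G\<^esub> x \<otimes>\<^bsub>G\<^esub> h \<otimes>\<^bsub>G\<^esub> inv\<^bsub>G\<^esub> (inv\<^bsub>G\<^esub> x)"
    if "x \<in> carrier G" "h \<in> carrier G" for x h
    using that by (simp add: inv_opposite_group is_group m_assoc)
  ultimately show ?thesis
    unfolding normal_inv_iff opp.normal_inv_iff subgroup_opposite_group[OF assms]
    by (auto simp: subset_iff dest: subgroup.subset)
qed

text \<open>The law to be shown is the given one with \<open>b\<close> and \<open>c\<close>
  exchanged; the inverse of \<open>a\<close> is the same in both groups.\<close>

lemma skew_brace_opposite_group:
  assumes "skew_brace A M"
  shows "skew_brace (opposite_group A) M"
proof -
  interpret skew_brace A M by fact
  show ?thesis
  proof (intro skew_brace.intro skew_brace_axioms.intro)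
    show "group (opposite_group A)"
      by (rule group_opposite_group) unfold_locales
    show "group M" by unfold_locales
    show "carrier M = carrier (opposite_group A)" by (simp add: carrier_eq)
    fix a b c
    assume "a \<in> carrier (opposite_group A)" "b \<in> carrier (opposite_group A)"
      "c \<in> carrier (opposite_group A)"
    moreover from this have "a \<otimes>\<^bsub>M\<^esub> b \<in> carrier A" "a \<otimes>\<^bsub>M\<^esub> c \<in> carrier A"
      using multiplicative.m_closed by (simp_all add: carrier_eq)
    ultimately show "a \<otimes>\<^bsub>M\<^esub> (b \<otimes>\<^bsub>opposite_group A\<^esub> c) =
        a \<otimes>\<^bsub>M\<^esub> b \<otimes>\<^bsub>opposite_group A\<^esub> inv\<^bsub>opposite_group A\<^esub> a \<otimes>\<^bsub>opposite_group A\<^esub> (a \<otimes>\<^bsub>M\<^esub> c)"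
      by (simp add: inv_opposite_group additive.is_group brace_law additive.m_assoc)
  qed
qed

lemma strong_left_ideal_iff:
  assumes "skew_brace A M"
  shows "strong_left_ideal H A M \<longleftrightarrow>
    subgroup H M \<and> H \<lhd> A \<and> (\<forall>a\<in>carrier A. \<forall>h\<in>H. brace_gamma A M a h \<in> H)"
  using assms
  unfolding strong_left_ideal_def strong_left_ideal_axioms_def by blast

lemma brace_ideal_iff:
  "brace_ideal H A M \<longleftrightarrow> strong_left_ideal H A M \<and> H \<lhd> M"
  unfolding brace_ideal_def by blast

text \<open>Meant for words bracketed to the right by \<open>m_assoc\<close>, where neighbouring
  inverses no longer form a subterm of their own.\<close>

lemma (in group) inv_cancel_left:
  assumes "x \<in> carrier G" "y \<in> carrier G"
  shows "inv x \<otimes> (x \<otimes> y) = y" "x \<otimes> (inv x \<otimes> y) = y"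
  using assms by (simp_all flip: m_assoc)

section \<open>The circle group of an abelian map\<close>

locale abelian_map_group = group G for G (structure) and \<psi> +
  assumes abelian_map: "abelian_map G \<psi>"
begin

sublocale psi: group_hom G G \<psi>
  using abelian_map by unfold_locales (simp add: abelian_map_def)

abbreviation "circle \<equiv> circle_group G \<psi>"
abbreviation "phi \<equiv> phi_map G \<psi>"

text \<open>Commutativity of the image enters here; all later exchanges rest on this rule.\<close>

lemma psi_commute:
  assumes "x \<in> carrier G" "y \<in> carrier G"
  shows "\<psi> x \<otimes> \<psi> y = \<psi> y \<otimes> \<psi> x"
proof -
  interpret image: comm_group "G\<lparr>carrier := \<psi> ` carrier G\<rparr>"
    using abelian_map by (simp add: abelian_map_def)
  show ?thesis using image.m_comm[of "\<psi> x" "\<psi> y"] assms by simp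
qed

lemma psi_left_commute:
  assumes "x \<in> carrier G" "y \<in> carrier G" "z \<in> carrier G"
  shows "\<psi> x \<otimes> (\<psi> y \<otimes> z) = \<psi> y \<otimes> (\<psi> x \<otimes> z)"
  using assms by (simp add: psi_commute flip: m_assoc)

lemma psi_conj:
  assumes "x \<in> carrier G" "y \<in> carrier G"
  shows "\<psi> x \<otimes> \<psi> y \<otimes> inv (\<psi> x) = \<psi> y" "inv (\<psi> x) \<otimes> \<psi> y \<otimes> \<psi> x = \<psi> y"
  using assms by (simp_all add: psi_commute[of x y] m_assoc inv_cancel_left)
    (simp add: psi_commute[of y x] inv_cancel_left)

lemma circle_simps [simp]:
  "carrier circle = carrier G" "\<one>\<^bsub>circle\<^esub> = \<one>"
  by (simp_all add: circle_group_def)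

lemma phi_eq: "x \<in> carrier G \<Longrightarrow> phi x = x \<otimes> inv (\<psi> x)"
  by (simp add: phi_map_def)

lemma phi_closed [simp]: "x \<in> carrier G \<Longrightarrow> phi x \<in> carrier G"
  by (simp add: phi_map_def)

lemma circle_mult:
  "x \<in> carrier G \<Longrightarrow> x \<otimes>\<^bsub>circle\<^esub> y = x \<otimes> inv (\<psi> x) \<otimes> y \<otimes> \<psi> x"
  by (simp add: circle_group_def)

text \<open>Under \<psi>, the conjugation inside the circle product becomes conjugation by
  \<open>\<psi> (\<psi> x)\<close>, which is trivial on the abelian image.\<close>

lemma psi_circle_mult:
  assumes "x \<in> carrier G" "y \<in> carrier G"
  shows "\<psi> (x \<otimes>\<^bsub>circle\<^esub> y) = \<psi> x \<otimes> \<psi> y"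
proof -
  have "\<psi> (x \<otimes>\<^bsub>circle\<^esub> y) = \<psi> x \<otimes> (inv (\<psi> (\<psi> x)) \<otimes> \<psi> y \<otimes> \<psi> (\<psi> x))"
    using assms by (simp add: circle_mult m_assoc)
  then show ?thesis using assms by (simp add: psi_conj)
qed

lemma circle_closed [simp]:
  "x \<in> carrier G \<Longrightarrow> y \<in> carrier G \<Longrightarrow> x \<otimes>\<^bsub>circle\<^esub> y \<in> carrier G"
  by (simp add: circle_mult)

text \<open>The argument is the future circle inverse of \<open>x\<close>. Its image is needed
  because the circle product applies \<psi> to its left factor.\<close>

lemma psi_circle_inv:
  assumes "x \<in> carrier G"
  shows "\<psi> (\<psi> x \<otimes> inv x \<otimes> inv (\<psi> x)) = inv (\<psi> x)"
  using assms psi_conj(1)[of "\<psi> x" "inv x"] by simp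

lemma circle_inv_mult_aux:
  assumes "x \<in> carrier G" "y \<in> carrier G"
  shows "\<psi> x \<otimes> inv x \<otimes> inv (\<psi> x) \<otimes>\<^bsub>circle\<^esub> y = \<psi> x \<otimes> inv x \<otimes> y \<otimes> inv (\<psi> x)"
  using assms
  \<comment> \<open>Without \<open>psi.hom_mult\<close>, the image of the candidate inverse keeps
    the form that \<open>psi_circle_inv\<close> matches.\<close>
  by (subst circle_mult) (simp_all add: psi_circle_inv del: psi.hom_mult,
      simp add: m_assoc inv_cancel_left)

lemma group_circle: "group circle"
proof (rule groupI)
  fix x y z assume "x \<in> carrier circle" "y \<in> carrier circle" "z \<in> carrier circle"
  then have xyz: "x \<in> carrier G" "y \<in> carrier G" "z \<in> carrier G" by simp_all
  \<comment> \<open>These exchanges bring both bracketings to the common form \<open>x \<otimes> inv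
    (\<psi> x) \<otimes> y \<otimes> inv (\<psi> y) \<otimes> z \<otimes> \<psi> y \<otimes> \<psi>
    x\<close>.\<close>
  have comm: "inv (\<psi> y) \<otimes> inv (\<psi> x) = inv (\<psi> x) \<otimes> inv (\<psi> y)"
    "\<psi> x \<otimes> (inv (\<psi> y) \<otimes> w) = inv (\<psi> y) \<otimes> (\<psi> x \<otimes> w)" if "w \<in> carrier G" for w
    using xyz that psi_commute[of "inv x" "inv y"] psi_left_commute[of x "inv y" w] by simp_all
  show "x \<otimes>\<^bsub>circle\<^esub> y \<otimes>\<^bsub>circle\<^esub> z = x \<otimes>\<^bsub>circle\<^esub> (y \<otimes>\<^bsub>circle\<^esub> z)"
    unfolding circle_mult[OF circle_closed[OF xyz(1,2)]] psi_circle_mult[OF xyz(1,2)]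
    using xyz comm
    by (simp add: circle_mult m_assoc inv_mult_group inv_cancel_left psi_commute[of x y])
next
  fix x assume "x \<in> carrier circle"
  then have x: "x \<in> carrier G" by simp
  show "\<one>\<^bsub>circle\<^esub> \<otimes>\<^bsub>circle\<^esub> x = x"
    using x by (simp add: circle_mult)
  have "\<psi> x \<otimes> inv x \<otimes> inv (\<psi> x) \<otimes>\<^bsub>circle\<^esub> x = \<one>"
    using x by (simp add: circle_inv_mult_aux) (simp add: m_assoc)
  with x show "\<exists>y\<in>carrier circle. y \<otimes>\<^bsub>circle\<^esub> x = \<one>\<^bsub>circle\<^esub>"
    by (intro bexI[of _ "\<psi> x \<otimes> inv x \<otimes> inv (\<psi> x)"]) simp_all
qed simp_all

lemma circle_inv:
  assumes x: "x \<in> carrier G"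
  shows "inv\<^bsub>circle\<^esub> x = \<psi> x \<otimes> inv x \<otimes> inv (\<psi> x)"
proof (rule group.inv_equality[OF group_circle])
  show "\<psi> x \<otimes> inv x \<otimes> inv (\<psi> x) \<otimes>\<^bsub>circle\<^esub> x = \<one>\<^bsub>circle\<^esub>"
    using x by (simp add: circle_inv_mult_aux) (simp add: m_assoc)
qed (use x in simp_all)

lemma circle_inv_closed [simp]: "x \<in> carrier G \<Longrightarrow> inv\<^bsub>circle\<^esub> x \<in> carrier G"
  by (simp add: circle_inv)

lemma circle_inv_mult:
  assumes "x \<in> carrier G" "y \<in> carrier G"
  shows "inv\<^bsub>circle\<^esub> x \<otimes>\<^bsub>circle\<^esub> y = \<psi> x \<otimes> inv x \<otimes> y \<otimes> inv (\<psi> x)"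
  using assms by (simp add: circle_inv circle_inv_mult_aux)

text \<open>On the right, the factors between \<open>y\<close> and \<open>z\<close> are
  \<open>\<psi> x\<close>, \<open>inv x\<close>, \<open>x\<close>, \<open>inv (\<psi> x)\<close>,
  which cancel.\<close>

lemma skew_brace_G_circle: "skew_brace G circle"
proof (intro skew_brace.intro skew_brace_axioms.intro)
  show "x \<otimes>\<^bsub>circle\<^esub> (y \<otimes> z) = x \<otimes>\<^bsub>circle\<^esub> y \<otimes> inv x \<otimes> (x \<otimes>\<^bsub>circle\<^esub> z)"
    if "x \<in> carrier G" "y \<in> carrier G" "z \<in> carrier G" for x y z
    using that by (simp add: circle_mult m_assoc inv_cancel_left)
qed (simp_all add: group_circle is_group)

lemma skew_brace_circle_G: "skew_brace circle G"
proof (intro skew_brace.intro skew_brace_axioms.intro)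
  fix x y z assume "x \<in> carrier circle" "y \<in> carrier circle" "z \<in> carrier circle"
  then have xyz: "x \<in> carrier G" "y \<in> carrier G" "z \<in> carrier G" by simp_all
  interpret circle: group circle by (rule group_circle)
  \<comment> \<open>Reassociating isolates a factor that collapses to the conjugate of
    \<open>z\<close> by \<open>\<psi> x\<close>.\<close>
  have "x \<otimes>\<^bsub>G\<^esub> y \<otimes>\<^bsub>circle\<^esub> inv\<^bsub>circle\<^esub> x \<otimes>\<^bsub>circle\<^esub> (x \<otimes>\<^bsub>G\<^esub> z) =
      x \<otimes> y \<otimes>\<^bsub>circle\<^esub> (inv\<^bsub>circle\<^esub> x \<otimes>\<^bsub>circle\<^esub> (x \<otimes> z))"
    using xyz circle.m_assoc[of "x \<otimes> y" "inv\<^bsub>circle\<^esub> x" "x \<otimes> z"] by simp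
  also have "inv\<^bsub>circle\<^esub> x \<otimes>\<^bsub>circle\<^esub> (x \<otimes> z) = \<psi> x \<otimes> z \<otimes> inv (\<psi> x)"
    using xyz by (simp add: circle_inv_mult m_assoc inv_cancel_left)
  also have "x \<otimes> y \<otimes>\<^bsub>circle\<^esub> (\<psi> x \<otimes> z \<otimes> inv (\<psi> x)) =
      x \<otimes> y \<otimes> inv (\<psi> y) \<otimes> z \<otimes> (inv (\<psi> x) \<otimes> \<psi> x) \<otimes> \<psi> y"
    using xyz by (simp add: circle_mult m_assoc inv_mult_group inv_cancel_left)
  also have "\<dots> = x \<otimes> (y \<otimes>\<^bsub>circle\<^esub> z)"
    using xyz by (simp add: circle_mult m_assoc)
  finally show "x \<otimes>\<^bsub>G\<^esub> (y \<otimes>\<^bsub>circle\<^esub> z) =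
      x \<otimes>\<^bsub>G\<^esub> y \<otimes>\<^bsub>circle\<^esub> inv\<^bsub>circle\<^esub> x \<otimes>\<^bsub>circle\<^esub> (x \<otimes>\<^bsub>G\<^esub> z)" ..
qed (simp_all add: group_circle is_group)

section \<open>The gamma maps of the four braces\<close>

lemma gamma_G_circle:
  assumes "x \<in> carrier G" "y \<in> carrier G"
  shows "brace_gamma G circle x y = inv (\<psi> x) \<otimes> y \<otimes> \<psi> x"
  using assms by (simp add: brace_gamma_def circle_mult m_assoc inv_cancel_left)

lemma gamma_opposite_G_circle:
  assumes "x \<in> carrier G" "y \<in> carrier G"
  shows "brace_gamma (opposite_group G) circle x y = phi x \<otimes> y \<otimes> inv (phi x)"
  using assms
  by (simp add: brace_gamma_def inv_opposite_group is_group phi_eq circle_mult m_assoc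
      inv_mult_group)

lemma gamma_circle_G:
  assumes "x \<in> carrier G" "y \<in> carrier G"
  shows "brace_gamma circle G x y = \<psi> x \<otimes> y \<otimes> inv (\<psi> x)"
  using assms by (simp add: brace_gamma_def circle_inv_mult m_assoc inv_cancel_left)

text \<open>Holds since \<open>inv (phi y) \<otimes> y = \<psi> y\<close>; later computations are
  compared in this shorter form.\<close>

lemma commutator_phi_mult:
  assumes "x \<in> carrier G" "y \<in> carrier G"
  shows "x \<otimes> phi y \<otimes> inv x \<otimes> inv (phi y) \<otimes> y = x \<otimes> phi y \<otimes> inv x \<otimes> \<psi> y"
  using assms by (simp add: phi_eq m_assoc inv_mult_group inv_cancel_left)

lemma gamma_opposite_circle_G:
  assumes "x \<in> carrier G" "y \<in> carrier G"
  shows "brace_gamma (opposite_group circle) G x y =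
    x \<otimes> phi y \<otimes> inv x \<otimes> inv (phi y) \<otimes> y"
  unfolding commutator_phi_mult[OF assms]
  using assms
  by (simp add: brace_gamma_def inv_opposite_group group_circle circle_inv phi_eq circle_mult m_assoc
      inv_mult_group inv_cancel_left)

lemma circle_conj:
  assumes "x \<in> carrier G" "y \<in> carrier G"
  shows "x \<otimes>\<^bsub>circle\<^esub> y \<otimes>\<^bsub>circle\<^esub> inv\<^bsub>circle\<^esub> x =
    phi x \<otimes> phi y \<otimes> inv (phi x) \<otimes> inv (phi y) \<otimes> y"
proof -
  have "inv (\<psi> x) \<otimes> (\<psi> y \<otimes> \<psi> x) = \<psi> y"
    using assms psi_conj(2)[of x y] by (simp add: m_assoc)
  then show ?thesis
    using assms psi_commute[of x y]
    \<comment> \<open>The outer product is opened first, so that \<open>psi_circle_mult\<close> can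
      evaluate \<psi> on the inner one.\<close>
    by (subst circle_mult)
      (simp_all add: commutator_phi_mult psi_circle_mult circle_inv phi_eq,
       simp_all add: circle_mult m_assoc inv_mult_group inv_cancel_left)
qed

text \<open>The factor \<open>inv (\<psi> y)\<close> ending \<open>phi y\<close> commutes with
  \<open>inv (\<psi> x)\<close> and cancels the final \<open>\<psi> y\<close>.\<close>

lemma commutator_psi_phi:
  assumes "x \<in> carrier G" "y \<in> carrier G"
  shows "\<psi> x \<otimes> phi y \<otimes> inv (\<psi> x) \<otimes> inv (phi y) \<otimes> y = \<psi> x \<otimes> y \<otimes> inv (\<psi> x)"
proof -
  have "inv (\<psi> y) \<otimes> (inv (\<psi> x) \<otimes> \<psi> y) = inv (\<psi> x)"
    using assms psi_conj(2)[of y "inv x"] by (simp add: m_assoc)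
  then show ?thesis
    using assms by (simp add: commutator_phi_mult) (simp add: phi_eq m_assoc)
qed

text \<open>Conjugating \<open>x\<close> by \<open>\<psi> x\<close> does not change its image under
  \<psi>, so \<open>phi\<close> of the conjugate is
  \<open>inv (\<psi> x) \<otimes> x\<close>.\<close>

lemma psi_mult_phi:
  assumes "x \<in> carrier G"
  shows "\<psi> x \<otimes> phi (inv (\<psi> x) \<otimes> x \<otimes> \<psi> x) = x"
proof -
  have "\<psi> (inv (\<psi> x) \<otimes> x \<otimes> \<psi> x) = \<psi> x"
    using assms psi_conj(2)[of "\<psi> x" x] by simp
  then show ?thesis
    using assms by (simp add: phi_eq m_assoc inv_cancel_left)
qed

end

section \<open>Subgroups of the circle group\<close>

locale abelian_map_subgroup = abelian_map_group + subgroup H G for H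
begin

lemma carrierI: "h \<in> H \<Longrightarrow> h \<in> carrier G"
  using subset by blast

lemma mult_right_mem_iff:
  assumes "x \<in> carrier G" "h \<in> H"
  shows "x \<otimes> h \<in> H \<longleftrightarrow> x \<in> H"
  using assms by (metis carrierI inv_closed m_closed m_inv_closed inv_solve_right)

text \<open>It suffices to test generators, and appending \<open>h\<close> from \<open>H\<close>
  does not affect membership. The appended form is the one in the gamma and circle conjugation
  formulas.\<close>

lemma commutator_subgroup_subset_iff:
  "commutator_subgroup G (carrier G) (phi ` H) \<subseteq> H \<longleftrightarrow>
    (\<forall>x\<in>carrier G. \<forall>h\<in>H. x \<otimes> phi h \<otimes> inv x \<otimes> inv (phi h) \<otimes> h \<in> H)" (is "?L \<longleftrightarrow> ?R")
proof -
  let ?S = "{x \<otimes> y \<otimes> inv x \<otimes> inv y | x y. x \<in> carrier G \<and> y \<in> phi ` H}"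
  have "?L \<longleftrightarrow> ?S \<subseteq> H"
    unfolding commutator_subgroup_def
    using generate_subgroup_incl[OF _ subgroup_axioms] generate.incl[of _ ?S G] by blast
  also have "\<dots> \<longleftrightarrow> (\<forall>x\<in>carrier G. \<forall>h\<in>H. x \<otimes> phi h \<otimes> inv x \<otimes> inv (phi h) \<in> H)"
    by blast
  also have "\<dots> \<longleftrightarrow> ?R"
    by (simp add: mult_right_mem_iff carrierI)
  finally show ?thesis .
qed

text \<open>The circle product of \<open>h\<close> and \<open>k\<close> is \<open>h\<close> times
  the conjugate of \<open>k\<close> by \<open>\<psi> (inv h)\<close>, and the circle inverse of
  \<open>h\<close> is the conjugate of \<open>inv h\<close> by \<open>\<psi> h\<close>.\<close>

lemma subgroup_circle:
  assumes conj: "\<And>x h. x \<in> carrier G \<Longrightarrow> h \<in> H \<Longrightarrow> \<psi> x \<otimes> h \<otimes> inv (\<psi> x) \<in> H"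
  shows "subgroup H circle"
proof (rule group.subgroupI[OF group_circle])
  show "H \<subseteq> carrier circle" using subset by simp
  show "H \<noteq> {}" using subgroup.one_closed[OF subgroup_axioms] by blast
  fix h assume h: "h \<in> H"
  show "inv\<^bsub>circle\<^esub> h \<in> H"
    using conj[of h "inv h"] h by (simp add: circle_inv carrierI)
  fix k assume k: "k \<in> H"
  show "h \<otimes>\<^bsub>circle\<^esub> k \<in> H"
    using m_closed[OF h conj[of "inv h" k]] h k by (simp add: circle_mult carrierI m_assoc)
qed

text \<open>The nontrivial direction writes \<open>x\<close> as \<open>\<psi> x \<otimes> phi z\<close>, with \<open>z\<close> as in \<open>psi_mult_phi\<close>,
  and uses \<open>[u v, w] = u [v, w] u\<^sup>-\<^sup>1 [u, w]\<close>.\<close>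

lemma commutator_iff_circle_normal:
  "(\<forall>x\<in>carrier G. \<forall>h\<in>H. x \<otimes> phi h \<otimes> inv x \<otimes> inv (phi h) \<otimes> h \<in> H) \<longleftrightarrow>
    H \<lhd> circle \<and> (\<forall>x\<in>carrier G. \<forall>h\<in>H. \<psi> x \<otimes> h \<otimes> inv (\<psi> x) \<in> H)" (is "?L \<longleftrightarrow> ?R")
proof
  assume L: ?L
  \<comment> \<open>Taking \<open>\<psi> x\<close> for the group element turns the commutator term
    into a conjugate, as \<open>subgroup_circle\<close> requires.\<close>
  have conj: "\<psi> x \<otimes> h \<otimes> inv (\<psi> x) \<in> H" if "x \<in> carrier G" "h \<in> H" for x h
    using L[rule_format, of "\<psi> x" h] that by (simp add: commutator_psi_phi carrierI)
  then show ?R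
    using L by (simp add: group.normal_inv_iff[OF group_circle] subgroup_circle circle_conj carrierI)
next
  assume R: ?R
  then have conj: "\<psi> x \<otimes> h \<otimes> inv (\<psi> x) \<in> H" if "x \<in> carrier G" "h \<in> H" for x h
    using that by blast
  have circ: "phi x \<otimes> phi h \<otimes> inv (phi x) \<otimes> inv (phi h) \<otimes> h \<in> H"
    if "x \<in> carrier G" "h \<in> H" for x h
    using R that by (simp add: group.normal_inv_iff[OF group_circle] circle_conj carrierI)
  show ?L
  proof (intro ballI)
    fix x h assume x: "x \<in> carrier G" and h: "h \<in> H"
    define v where "v = phi (inv (\<psi> x) \<otimes> x \<otimes> \<psi> x)"
    have v: "v \<in> carrier G" and xv: "x = \<psi> x \<otimes> v"
      using x by (simp_all add: v_def psi_mult_phi)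
    have "v \<otimes> phi h \<otimes> inv v \<otimes> inv (phi h) \<otimes> h \<in> H"
      unfolding v_def using x h by (intro circ) simp_all
    from conj[OF x this]
    have "\<psi> x \<otimes> (v \<otimes> phi h \<otimes> inv v \<otimes> \<psi> h) \<otimes> inv (\<psi> x) \<in> H"
      using v h by (simp add: commutator_phi_mult carrierI)
    \<comment> \<open>The last bracket on the right equals \<open>\<psi> h\<close> by
      \<open>psi_conj\<close>, which restores the commutator form at \<open>x\<close>.\<close>
    also have "\<psi> x \<otimes> (v \<otimes> phi h \<otimes> inv v \<otimes> \<psi> h) \<otimes> inv (\<psi> x) =
        (\<psi> x \<otimes> v) \<otimes> phi h \<otimes> inv (\<psi> x \<otimes> v) \<otimes> (\<psi> x \<otimes> \<psi> h \<otimes> inv (\<psi> x))"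
      using x v h by (simp add: m_assoc inv_mult_group inv_cancel_left carrierI)
    finally show "x \<otimes> phi h \<otimes> inv x \<otimes> inv (phi h) \<otimes> h \<in> H"
      using x h by (simp add: commutator_phi_mult carrierI psi_conj flip: xv)
  qed
qed

text \<open>Normality in \<open>G\<close> already supplies the conjugation conjunct of
  \<open>commutator_iff_circle_normal\<close>.\<close>

lemma commutator_subgroup_subset_iff_circle_normal:
  assumes "H \<lhd> G"
  shows "commutator_subgroup G (carrier G) (phi ` H) \<subseteq> H \<longleftrightarrow> H \<lhd> circle"
  unfolding commutator_subgroup_subset_iff commutator_iff_circle_normal
  using assms by (simp add: normal_inv_iff)

section \<open>Strong left ideals of the four braces\<close>

lemma normal_psi_conj:
  assumes "H \<lhd> G" "x \<in> carrier G" "h \<in> H"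
  shows "\<psi> x \<otimes> h \<otimes> inv (\<psi> x) \<in> H"
  using assms by (simp add: normal_inv_iff)

text \<open>As gamma is conjugation by \<open>\<psi> x\<close>, the ideal conditions are the right
  side of \<open>commutator_iff_circle_normal\<close>.\<close>

lemma strong_left_ideal_circle_G:
  "strong_left_ideal H circle G \<longleftrightarrow> commutator_subgroup G (carrier G) (phi ` H) \<subseteq> H"
  unfolding commutator_subgroup_subset_iff commutator_iff_circle_normal
    strong_left_ideal_iff[OF skew_brace_circle_G]
  by (simp add: gamma_circle_G subgroup_axioms carrierI)

text \<open>Here gamma invariance is itself the commutator condition, and normality in
  \<open>circle\<close> follows from it.\<close>

lemma strong_left_ideal_opposite_circle_G:
  "strong_left_ideal H (opposite_group circle) G \<longleftrightarrow>
    commutator_subgroup G (carrier G) (phi ` H) \<subseteq> H"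
  using commutator_iff_circle_normal
  unfolding commutator_subgroup_subset_iff
    strong_left_ideal_iff[OF skew_brace_opposite_group[OF skew_brace_circle_G]]
    normal_opposite_group[OF group_circle]
  by (auto simp: gamma_opposite_circle_G subgroup_axioms carrierI)

lemma strong_left_ideal_G_circle:
  "strong_left_ideal H G circle \<longleftrightarrow> H \<lhd> G"
proof -
  \<comment> \<open>This is conjugation by \<open>\<psi> (inv x)\<close>.\<close>
  have "inv (\<psi> x) \<otimes> h \<otimes> \<psi> x \<in> H" if "H \<lhd> G" "x \<in> carrier G" "h \<in> H" for x h
    using normal_psi_conj[of "inv x" h] that by simp
  then show ?thesis
    unfolding strong_left_ideal_iff[OF skew_brace_G_circle]
    by (auto simp: gamma_G_circle carrierI intro!: subgroup_circle normal_psi_conj)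
qed

lemma strong_left_ideal_opposite_G_circle:
  "strong_left_ideal H (opposite_group G) circle \<longleftrightarrow> H \<lhd> G"
  unfolding strong_left_ideal_iff[OF skew_brace_opposite_group[OF skew_brace_G_circle]]
    normal_opposite_group[OF is_group]
  by (auto simp: gamma_opposite_G_circle carrierI normal_inv_iff intro!: subgroup_circle)

end

theorem theorem1:
  fixes G :: "('a, 'b) monoid_scheme" and \<psi> :: "'a \<Rightarrow> 'a" and H :: "'a set"
  assumes "group G"
    and "abelian_map G \<psi>"
    and "subgroup H G"
  defines "C1 \<equiv> commutator_subgroup G (carrier G) (phi_map G \<psi> ` H) \<subseteq> H"
    and "C2 \<equiv> H \<lhd> G"
  shows
    "((strong_left_ideal H (circle_group G \<psi>) G \<longleftrightarrow> C1) \<and>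
      (strong_left_ideal H (opposite_group (circle_group G \<psi>)) G \<longleftrightarrow> C1)) \<and>
     ((strong_left_ideal H G (circle_group G \<psi>) \<longleftrightarrow> C2) \<and>
      (strong_left_ideal H (opposite_group G) (circle_group G \<psi>) \<longleftrightarrow> C2)) \<and>
     ((brace_ideal H G (circle_group G \<psi>) \<longleftrightarrow> C1 \<and> C2) \<and>
      (brace_ideal H (opposite_group G) (circle_group G \<psi>) \<longleftrightarrow> C1 \<and> C2) \<and>
      (brace_ideal H (opposite_group (circle_group G \<psi>)) G \<longleftrightarrow> C1 \<and> C2))"
proof -
  interpret abelian_map_subgroup G \<psi> H
    by (intro abelian_map_subgroup.intro abelian_map_group.intro abelian_map_group_axioms.intro
        assms(1-3))
  show ?thesis
    unfolding C1_def C2_def brace_ideal_iff strong_left_ideal_circle_G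
      strong_left_ideal_opposite_circle_G strong_left_ideal_G_circle
      strong_left_ideal_opposite_G_circle
    \<comment> \<open>For the first two braces an ideal must also be normal in
      \<open>circle\<close>, which under \<open>C2\<close> amounts to \<open>C1\<close>; for the
      third the extra demand is \<open>C2\<close> itself.\<close>
    using commutator_subgroup_subset_iff_circle_normal by blast
qed

end
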